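(* Let $b_2^{\pm} := (3\pm\sqrt{3})/6$. For every real $\sigma$ with $-1<\sigma<0$: if $b_2^-\le a\le 1/2$ then $\zeta(\sigma,a)>0$, and if $b_2^+\le a\le 1$ then $\zeta(\sigma,a)<0$.
   Context: For $0<a\le 1$, $\zeta(s,a)$ denotes the Hurwitz zeta function, defined by $\zeta(s,a)=\sum_{n=0}^\infty (n+a)^{-s}$ for $\Re(s)>1$ and by analytic continuation to a meromorphic function on $\mathbb{C}$ with only a simple pole at $s=1$. *)

theory Defs
  imports "HOL-Complex_Analysis.Complex_Analysis"
begin

text \<open>
  The predicate describes the meromorphic continuation to the whole complex plane of the
  Hurwitz series with parameter \<open>a\<close>, whose only pole is a simple one at 1. HOL functions are total;
  the condition \<open>f 1 = 0\<close> fixes the irrelevant value at the pole, which makes \<open>f\<close> unique.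
\<close>

definition is_hurwitz_zeta :: "real \<Rightarrow> (complex \<Rightarrow> complex) \<Rightarrow> bool" where
  "is_hurwitz_zeta a f \<longleftrightarrow>
     f holomorphic_on (- {1}) \<and> is_pole f 1 \<and> zorder f 1 = -1 \<and> f 1 = 0 \<and>
     (\<forall>s. Re s > 1 \<longrightarrow> f s = (\<Sum>n. complex_of_real (real n + a) powr (- s)))"

lemma is_hurwitz_zeta_unique:
  assumes "is_hurwitz_zeta a f" and "is_hurwitz_zeta a g"
  shows "f = g"
proof
  fix s :: complex
  show "f s = g s"
  proof (cases "s = 1")
    case True
    then show ?thesis using assms by (simp add: is_hurwitz_zeta_def)
  next
    case False
    have hol: "(\<lambda>z. f z - g z) holomorphic_on (- {1})"
      using assms by (auto simp: is_hurwitz_zeta_def intro!: holomorphic_intros)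
    have conn: "connected (- {1 :: complex})"
      by (rule connected_punctured_universe) simp
    have "open {z. Re z > 1}"
      by (rule open_halfspace_Re_gt)
    then have lim: "2 islimpt {z. Re z > 1}"
      by (rule open_imp_islimpt) simp
    have "f s - g s = 0"
      by (rule analytic_continuation[OF hol _ conn _ _ lim])
         (use False assms in \<open>auto simp: is_hurwitz_zeta_def\<close>)
    then show ?thesis by simp
  qed
qed

text \<open>
  \<open>hurwitz_zeta a s\<close> is \<open>\<zeta>(s,a)\<close>; it is only meant for \<open>0 < a \<le> 1\<close>.
\<close>

definition hurwitz_zeta :: "real \<Rightarrow> complex \<Rightarrow> complex" where
  "hurwitz_zeta a = (THE f. is_hurwitz_zeta a f)"

definition b2_minus :: real where "b2_minus = (3 - sqrt 3) / 6"

definition b2_plus :: real where "b2_plus = (3 + sqrt 3) / 6"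

end

theory Submission
  imports Defs
begin

text \<open>
  For \<open>-1 < \<sigma> < 0\<close> and \<open>p = -\<sigma>\<close>, subtracting telescoping terms from the Hurwitz series gives
  \<open>\<zeta>(\<sigma>, a) = (\<Sum>n. T n a)\<close>, where \<open>T n a = f (n + a) - \<integral>\<^sub>n\<^sup>n\<^sup>+\<^sup>1 f - (a - 1/2) (f (n + 1) - f n)\<close> and
  \<open>f t = t powr p\<close>. Every \<open>T n\<close> has the required sign. It is concave in \<open>a\<close>, and it is positive at
  \<open>a = 1/2\<close> because \<open>f\<close> is concave. At the roots \<open>b\<^sub>2\<^sup>\<plusminus>\<close> of the second Bernoulli polynomial the
  functional is exact on quadratic polynomials, and the positive third derivative of \<open>f\<close> makes it positive at \<open>b\<^sub>2\<^sup>-\<close> and negative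
  at \<open>b\<^sub>2\<^sup>+\<close>. Concavity settles the remaining \<open>a\<close>.
\<close>

subsection \<open>Analytic continuation of the Hurwitz series\<close>

text \<open>Near each point the exponent stays away from 1 and \<open>C\<close> is bounded by
  compactness, so the Weierstrass M-test applies. The bound is asked only for
  \<open>n \<ge> 1\<close>, since \<open>0 powr _ = 0\<close> would force \<open>g 0\<close> to
  vanish.\<close>

lemma holomorphic_suminf_powr_bound:
  assumes "open U" and hol: "\<And>n. g n holomorphic_on U" and cont: "continuous_on U C"
    and bd: "\<And>n s. n \<ge> 1 \<Longrightarrow> s \<in> U \<Longrightarrow> norm (g n s) \<le> C s * real n powr - (Re s + q)"
    and q: "\<And>s. s \<in> U \<Longrightarrow> Re s + q > 1"
  shows "(\<lambda>s. \<Sum>n. g n s) holomorphic_on U"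
    and "\<And>s. s \<in> U \<Longrightarrow> summable (\<lambda>n. g n s)"
proof -
  obtain G where G: "\<forall>s\<in>U. ((\<lambda>n. g n s) sums G s) \<and> G field_differentiable (at s)"
  proof (rule series_differentiable_comparison_complex[OF \<open>open U\<close>, of g])
    show "g n field_differentiable at s" if "s \<in> U" for n s
      using hol[of n] that \<open>open U\<close> holomorphic_on_imp_differentiable_at by blast
  next
    fix s assume s: "s \<in> U"
    \<comment> \<open>Half of the gap above 1: moving by at most \<open>\<delta>\<close> leaves
      \<open>Re y + q \<ge> 1 + \<delta>\<close>.\<close>
    define \<delta> where "\<delta> = (Re s + q - 1) / 2"
    have \<delta>: "\<delta> > 0" using q[OF s] by (simp add: \<delta>_def)
    obtain e where e: "e > 0" "cball s e \<subseteq> U"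
      using \<open>open U\<close> s open_contains_cball by blast
    define d where "d = min e \<delta>"
    have d: "d > 0" "cball s d \<subseteq> U" "d \<le> \<delta>"
      using e \<delta> by (auto simp: d_def)
    have "compact (C ` cball s d)"
      by (intro compact_continuous_image continuous_on_subset[OF cont] d compact_cball)
    then obtain B where B: "B > 0" "\<And>y. y \<in> cball s d \<Longrightarrow> norm (C y) \<le> B"
      by (metis bounded_pos compact_imp_bounded imageI)
    define h where "h = (\<lambda>n. complex_of_real (B * real n powr - (1 + \<delta>)))"
    have "summable (\<lambda>n. real n powr - (1 + \<delta>))"
      using \<delta> by (subst summable_real_powr_iff) auto
    then have "summable h"
      unfolding h_def by (intro summable_of_real summable_mult)
    moreover have "norm (g n y) \<le> norm (h n)" if "n \<ge> 1" "y \<in> ball s d \<inter> U" for n y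
    proof -
      have y: "y \<in> cball s d" using that by auto
      have "\<bar>Re (s - y)\<bar> \<le> d"
        using y abs_Re_le_cmod[of "s - y"] by (simp add: dist_norm)
      then have re: "Re y + q \<ge> 1 + \<delta>"
        using d(3) by (simp add: \<delta>_def field_simps)
      have "norm (g n y) \<le> C y * real n powr - (Re y + q)"
        using bd that by blast
      also have "\<dots> \<le> B * real n powr - (Re y + q)"
        using B(2)[OF y] by (intro mult_right_mono) auto
      also have "\<dots> \<le> B * real n powr - (1 + \<delta>)"
        using B(1) re that(1) by (intro mult_left_mono powr_mono) auto
      finally show ?thesis using B(1) by (simp add: h_def norm_mult)
    qed
    then have "\<forall>\<^sub>F n in sequentially. \<forall>y\<in>ball s d \<inter> U. norm (g n y) \<le> norm (h n)"
      using eventually_sequentially by blast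
    moreover have "range h \<subseteq> \<real>\<^sub>\<ge>\<^sub>0"
      using B(1) by (auto simp: h_def complex_nonneg_Reals_iff)
    ultimately show "\<exists>d h. 0 < d \<and> summable h \<and> range h \<subseteq> \<real>\<^sub>\<ge>\<^sub>0 \<and>
        (\<forall>\<^sub>F n in sequentially. \<forall>y\<in>ball s d \<inter> U. cmod (g n y) \<le> cmod (h n))"
      using d(1) by (intro exI[of _ d] exI[of _ h] conjI)
  qed
  then have "G holomorphic_on U"
    using \<open>open U\<close> by (auto simp: holomorphic_on_open field_differentiable_def)
  moreover have "(\<Sum>n. g n s) = G s" if "s \<in> U" for s
    using G that sums_unique by force
  ultimately show "(\<lambda>s. \<Sum>n. g n s) holomorphic_on U"
    by (subst holomorphic_cong) auto
  show "\<And>s. s \<in> U \<Longrightarrow> summable (\<lambda>n. g n s)"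
    using G sums_summable by blast
qed

text \<open>Taylor's theorem on the segment from \<open>x\<close> to \<open>x + h\<close>. The bound
  on \<open>Re w\<close> lets the derivative of order \<open>Suc K\<close> be estimated by its
  modulus at \<open>x\<close>. The factor \<open>Suc K\<close> arises because the complex remainder
  estimate divides by \<open>fact K\<close>.\<close>

lemma powr_Taylor_bound:
  fixes w :: complex and x h :: real
  assumes "x > 0" "h \<ge> 0" "Re w \<le> real (Suc K)"
  shows "norm (of_real (x + h) powr w - (\<Sum>i\<le>K. (w gchoose i) * of_real x powr (w - of_nat i) * of_real h ^ i))
         \<le> real (Suc K) * norm (w gchoose Suc K) * x powr (Re w - real (Suc K)) * h ^ Suc K"
proof -
  define f where "f = (\<lambda>i z. fact i * (w gchoose i) * z powr (w - of_nat i))"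
  define S where "S = closed_segment (complex_of_real x) (of_real (x + h))"
  have S: "\<exists>t\<ge>x. z = of_real t" if z: "z \<in> S" for z
  proof -
    obtain u where u: "0 \<le> u" "z = (1 - u) *\<^sub>R of_real x + u *\<^sub>R of_real (x + h)"
      using z unfolding S_def closed_segment_def by blast
    have "z = of_real (x + u * h)"
      unfolding u(2) by (simp add: scaleR_conv_of_real algebra_simps)
    moreover have "x + u * h \<ge> x" using u assms by simp
    ultimately show ?thesis by blast
  qed
  have "norm (f 0 (of_real (x + h)) - (\<Sum>i\<le>K. f i (of_real x) * (of_real (x + h) - of_real x) ^ i / fact i))
     \<le> (fact (Suc K) * norm (w gchoose Suc K) * x powr (Re w - real (Suc K))) *
        norm (of_real (x + h) - complex_of_real x) ^ Suc K / fact K"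
  proof (rule complex_Taylor[where S = S])
    show "convex S" by (simp add: S_def convex_closed_segment)
    show "complex_of_real x \<in> S" "complex_of_real (x + h) \<in> S" by (auto simp: S_def)
  next
    fix i z assume "z \<in> S"
    then obtain t where t: "t \<ge> x" "z = of_real t" using S by blast
    have nz: "z \<notin> \<real>\<^sub>\<le>\<^sub>0" using t assms by auto
    have rec: "(w - of_nat i) * (fact i * (w gchoose i)) = fact (Suc i) * (w gchoose Suc i)"
      by (simp only: gbinomial_mult_fact) (simp add: mult_ac)
    have e: "w - of_nat i - 1 = w - of_nat (Suc i)" by simp
    have "((\<lambda>z. fact i * (w gchoose i) * z powr (w - of_nat i)) has_field_derivative
        fact i * (w gchoose i) * ((w - of_nat i) * z powr (w - of_nat i - 1))) (at z within S)"
      using nz by (intro DERIV_cmult has_field_derivative_at_within[OF has_field_derivative_powr])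
    also have "fact i * (w gchoose i) * ((w - of_nat i) * z powr (w - of_nat i - 1)) = f (Suc i) z"
      unfolding f_def e rec[symmetric] by (simp only: mult_ac)
    finally show "(f i has_field_derivative f (Suc i) z) (at z within S)"
      unfolding f_def .
  next
    fix z assume "z \<in> S"
    then obtain t where t: "t \<ge> x" "z = of_real t" using S by blast
    have "norm (z powr (w - of_nat (Suc K))) = t powr (Re w - real (Suc K))"
      using t assms by (subst norm_powr_real_powr) auto
    also have "\<dots> \<le> x powr (Re w - real (Suc K))"
      using t assms by (intro powr_mono2') auto
    finally show "norm (f (Suc K) z) \<le> fact (Suc K) * norm (w gchoose Suc K) * x powr (Re w - real (Suc K))"
      unfolding f_def norm_mult norm_fact by (intro mult_left_mono) auto
  qed
  moreover have "f 0 = (\<lambda>z. z powr w)" by (auto simp: f_def)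
  moreover have "f i (of_real x) * (of_real (x + h) - of_real x) ^ i / fact i =
      (w gchoose i) * of_real x powr (w - of_nat i) * of_real h ^ i" for i
    by (simp add: f_def)
  ultimately show ?thesis
    using assms(2) by (simp add: mult_ac del: of_nat_Suc)
qed

section \<open>The Hurwitz series and its recursion in shifted arguments\<close>

definition hurwitz_series :: "real \<Rightarrow> complex \<Rightarrow> complex" where
  "hurwitz_series a s = (\<Sum>n. complex_of_real (real n + a) powr (- s))"

lemma holomorphic_on_gbinomial [holomorphic_intros]:
  fixes f :: "complex \<Rightarrow> complex"
  assumes "f holomorphic_on A"
  shows "(\<lambda>s. f s gchoose k) holomorphic_on A"
  unfolding gbinomial_prod_rev by (intro holomorphic_intros assms fact_nonzero)

lemma holomorphic_on_powr_of_real_pos [holomorphic_intros]: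
  assumes "x > 0" "f holomorphic_on A"
  shows "(\<lambda>s. complex_of_real x powr f s) holomorphic_on A"
  using assms(1) by (intro holomorphic_on_powr_right assms(2))

lemma connected_halfspace_Re_gt: "connected {s. c < Re s}"
  by (intro convex_connected convex_halfspace_Re_gt)

text \<open>Identity theorem on the smaller of the two half-planes, which meets
  \<open>1 < Re s\<close> in a nonempty open set.\<close>

lemma halfplane_continuation_unique:
  assumes "f holomorphic_on {s. c < Re s}" "g holomorphic_on {s. d < Re s}"
    and "\<And>s. 1 < Re s \<Longrightarrow> f s = g s" "c < Re s" "d < Re s"
  shows "f s = g s"
proof -
  let ?m = "max c d"
  define p where "p = complex_of_real (max 1 ?m + 1)"
  have "open {s. max 1 ?m < Re s}" by (rule open_halfspace_Re_gt)
  then have lim: "p islimpt {s. max 1 ?m < Re s}"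
    by (rule open_imp_islimpt) (simp add: p_def max_def)
  have "(\<lambda>s. f s - g s) holomorphic_on {s. ?m < Re s}"
    by (intro holomorphic_intros holomorphic_on_subset[OF assms(1)] holomorphic_on_subset[OF assms(2)]) auto
  then have "f s - g s = 0"
    by (rule analytic_continuation[OF _ open_halfspace_Re_gt connected_halfspace_Re_gt _ _ lim])
       (use assms in \<open>auto simp: p_def max_def split: if_splits\<close>)
  then show ?thesis by simp
qed

context
  fixes a :: real
  assumes a: "a > 0"
begin

lemma
  shows hurwitz_series_holomorphic: "hurwitz_series a holomorphic_on {s. 1 < Re s}"
    and hurwitz_series_sums:
      "1 < Re s \<Longrightarrow> (\<lambda>n. complex_of_real (real n + a) powr (- s)) sums hurwitz_series a s"
proof -
  have hol: "(\<lambda>s. complex_of_real (real n + a) powr - s) holomorphic_on {s. 1 < Re s}" for n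
    using a by (intro holomorphic_intros) auto
  have bound: "norm (complex_of_real (real n + a) powr - s) \<le> 1 * real n powr - (Re s + 0)"
    if "n \<ge> 1" "s \<in> {s. 1 < Re s}" for n s
  proof -
    have "norm (complex_of_real (real n + a) powr - s) = (real n + a) powr - Re s"
      using a by (subst norm_powr_real_powr) auto
    also have "\<dots> \<le> real n powr - Re s"
      using a that by (intro powr_mono2') auto
    finally show ?thesis by simp
  qed
  note * = holomorphic_suminf_powr_bound[OF open_halfspace_Re_gt hol continuous_on_const bound]
  show "hurwitz_series a holomorphic_on {s. 1 < Re s}"
    unfolding hurwitz_series_def by (rule *) auto
  show "(\<lambda>n. complex_of_real (real n + a) powr (- s)) sums hurwitz_series a s" if "1 < Re s"
    unfolding hurwitz_series_def by (intro summable_sums *(2)) (use that in auto)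
qed

lemma powr_telescope_sums:
  assumes "Re w < 0"
  shows "(\<lambda>n. complex_of_real (real n + a + 1) powr w - of_real (real n + a) powr w) sums (- (of_real a powr w))"
proof -
  have "filterlim (\<lambda>n. a + real n) at_top sequentially"
    by (intro filterlim_tendsto_add_at_top[OF tendsto_const] filterlim_real_sequentially)
  then have "(\<lambda>n. (real n + a) powr Re w) \<longlonglongrightarrow> 0"
    using assms by (intro tendsto_neg_powr) (simp_all add: add.commute)
  moreover have "norm (complex_of_real (real n + a) powr w) = (real n + a) powr Re w" for n
    using a by (subst norm_powr_real_powr) auto
  ultimately have "(\<lambda>n. complex_of_real (real n + a) powr w) \<longlonglongrightarrow> 0"
    by (subst tendsto_norm_zero_iff [symmetric]) simp
  from telescope_sums[OF this] show ?thesis by (simp add: add_ac)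
qed

text \<open>
  Expanding \<open>(x + 1)\<^sup>1\<^sup>-\<^sup>s\<close> at \<open>x = n + a\<close> and telescoping over \<open>n\<close> expresses \<open>(s - 1) \<zeta>(s, a)\<close> by the
  functions \<open>(s + j - 1) \<zeta>(s + j, a)\<close> with \<open>j \<ge> 1\<close>, up to the sum of these remainders. Multiplying
  by \<open>s - 1\<close> beforehand removes every pole from this recursion.
\<close>

definition step_remainder :: "nat \<Rightarrow> nat \<Rightarrow> complex \<Rightarrow> complex" where
  "step_remainder K n s = of_real (real n + a + 1) powr (1 - s) -
     (\<Sum>i\<le>K. ((1 - s) gchoose i) * of_real (real n + a) powr (1 - s - of_nat i))"

text \<open>Taylor's bound with step 1 and exponent \<open>1 - s\<close> makes the remainder of
  order \<open>n powr - (Re s + K)\<close>.\<close>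

lemma step_remainder_suminf_holomorphic:
  "(\<lambda>s. \<Sum>n. step_remainder K n s) holomorphic_on {s. 1 - real K < Re s}"
proof (rule holomorphic_suminf_powr_bound(1)
    [where C = "\<lambda>s. real (Suc K) * norm ((1 - s) gchoose Suc K)" and q = "real K"])
  show "step_remainder K n holomorphic_on {s. 1 - real K < Re s}" for n
    unfolding step_remainder_def using a by (intro holomorphic_intros) auto
  show "continuous_on {s. 1 - real K < Re s} (\<lambda>s. real (Suc K) * norm ((1 - s) gchoose Suc K))"
    by (intro continuous_intros holomorphic_on_imp_continuous_on holomorphic_intros)
next
  fix n :: nat and s assume n: "1 \<le> n" and s: "s \<in> {s. 1 - real K < Re s}"
  have "norm (step_remainder K n s) \<le> real (Suc K) * norm ((1 - s) gchoose Suc K) *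
      (real n + a) powr (Re (1 - s) - real (Suc K)) * 1 ^ Suc K"
    using powr_Taylor_bound[of "real n + a" 1 "1 - s" K] n a s
    unfolding step_remainder_def by (simp del: gbinomial_Suc0)
  also have "\<dots> \<le> real (Suc K) * norm ((1 - s) gchoose Suc K) * real n powr (Re (1 - s) - real (Suc K)) * 1 ^ Suc K"
    using n a s by (intro mult_right_mono mult_left_mono powr_mono2') auto
  also have "Re (1 - s) - real (Suc K) = - (Re s + real K)" by simp
  finally show "norm (step_remainder K n s) \<le>
      real (Suc K) * norm ((1 - s) gchoose Suc K) * real n powr - (Re s + real K)" by simp
qed (auto intro: open_halfspace_Re_gt)

text \<open>The term \<open>i = 0\<close> joins the telescoping difference, and
  \<open>i = Suc j\<close> sums to a multiple of the series at \<open>s + j\<close>. Rewriting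
  \<open>(1 - s) gchoose Suc j\<close> by \<open>(1 - s) gchoose j\<close> produces the factor
  \<open>s + j - 1\<close> that cancels the pole.\<close>

lemma step_remainder_sums:
  assumes s: "Re s > 1"
  shows "(\<lambda>n. step_remainder (Suc N) n s) sums
    (- (of_real a powr (1 - s)) +
      (\<Sum>j\<le>N. ((1 - s) gchoose j) / of_nat (Suc j) * ((s + of_nat j - 1) * hurwitz_series a (s + of_nat j))))"
proof -
  let ?w = "1 - s"
  have eq: "step_remainder (Suc N) n s =
      (of_real (real n + a + 1) powr ?w - of_real (real n + a) powr ?w) -
      (\<Sum>j\<le>N. (?w gchoose Suc j) * of_real (real n + a) powr (- (s + of_nat j)))" for n
  proof -
    have "?w - of_nat (Suc j) = - (s + of_nat j)" for j by simp
    then show ?thesis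
      unfolding step_remainder_def sum.atMost_Suc_shift by (simp only: gbinomial_0) simp
  qed
  have "(\<lambda>n. step_remainder (Suc N) n s) sums (- (of_real a powr ?w) -
      (\<Sum>j\<le>N. (?w gchoose Suc j) * hurwitz_series a (s + of_nat j)))"
    unfolding eq using s
    by (intro sums_diff powr_telescope_sums sums_sum sums_mult hurwitz_series_sums) auto
  moreover have "(?w gchoose Suc j) * hurwitz_series a (s + of_nat j) =
      - ((?w gchoose j) / of_nat (Suc j) * ((s + of_nat j - 1) * hurwitz_series a (s + of_nat j)))" for j
  proof -
    have "(?w gchoose Suc j) = (?w gchoose j) * (?w - of_nat j) / of_nat (Suc j)"
      using gbinomial_mult_1[of ?w j] by (simp add: field_simps del: of_nat_Suc)
    moreover have "s + of_nat j - 1 = - (?w - of_nat j)" by simp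
    ultimately show ?thesis
      by (simp only: mult_minus_left mult_minus_right minus_minus times_divide_eq_left
          times_divide_eq_right mult.assoc)
  qed
  ultimately show ?thesis by (simp add: sum_negf)
qed

text \<open>Solving the summed identity for its term \<open>j = 0\<close> leaves only the arguments
  \<open>s + 1\<close>, ..., \<open>s + N\<close>, which lie in the old half-plane whenever
  \<open>s\<close> lies in the new one. The value at 1 is the residue of the zeta function
  there.\<close>

lemma continuation_step:
  assumes hol: "E holomorphic_on {s. 1 - real N < Re s}"
    and E: "\<And>s. 1 < Re s \<Longrightarrow> E s = (s - 1) * hurwitz_series a s"
  obtains E' where "E' holomorphic_on {s. - real N < Re s}"
    "\<And>s. 1 < Re s \<Longrightarrow> E' s = (s - 1) * hurwitz_series a s" "E' 1 = 1"
proof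
  define E' where "E' = (\<lambda>s. of_real a powr (1 - s) + (\<Sum>n. step_remainder (Suc N) n s) -
     (\<Sum>j<N. ((1 - s) gchoose Suc j) / of_nat (Suc (Suc j)) * E (s + of_nat (Suc j))))"
  have "(\<lambda>s. E (s + of_nat (Suc j))) holomorphic_on {s. - real N < Re s}" for j
    by (rule holomorphic_on_compose_gen[OF _ hol, unfolded o_def])
       (auto intro!: holomorphic_intros)
  moreover have "(\<lambda>s. \<Sum>n. step_remainder (Suc N) n s) holomorphic_on {s. - real N < Re s}"
    using step_remainder_suminf_holomorphic[of "Suc N"] by simp
  ultimately show "E' holomorphic_on {s. - real N < Re s}"
    unfolding E'_def using a by (intro holomorphic_intros) auto
  show "E' s = (s - 1) * hurwitz_series a s" if s: "1 < Re s" for s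
  proof -
    have "(\<Sum>j\<le>N. ((1 - s) gchoose j) / of_nat (Suc j) * ((s + of_nat j - 1) * hurwitz_series a (s + of_nat j)))
      = (s - 1) * hurwitz_series a s + (\<Sum>j<N. ((1 - s) gchoose Suc j) / of_nat (Suc (Suc j)) * E (s + of_nat (Suc j)))"
      unfolding sum.atMost_shift using s by (simp add: E)
    then show ?thesis
      unfolding E'_def sums_unique[OF step_remainder_sums[OF s], symmetric] by simp
  qed
  \<comment> \<open>At \<open>s = 1\<close> the remainder is \<open>1 - 1\<close>, provided that the
    bases are nonzero, because \<open>0 powr 0 = 0\<close>.\<close>
  have "complex_of_real (real n + a) \<noteq> 0" "complex_of_real (real n + a + 1) \<noteq> 0" for n
    using a by (simp_all del: of_real_add)
  then have "step_remainder (Suc N) n 1 = 0" for n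
    using a unfolding step_remainder_def sum.atMost_Suc_shift
    by (simp add: gbinomial_0_left del: of_real_add)
  then show "E' 1 = 1"
    unfolding E'_def using a by (simp add: gbinomial_0_left)
qed

section \<open>Gluing the half-plane continuations\<close>

text \<open>Each step moves the boundary left by 1. The value at 1 is claimed only once the open
  half-plane contains that point.\<close>

lemma continuation_halfplane:
  "\<exists>E. E holomorphic_on {s. 1 - real N < Re s} \<and>
       (\<forall>s. 1 < Re s \<longrightarrow> E s = (s - 1) * hurwitz_series a s) \<and> (N > 0 \<longrightarrow> E 1 = 1)"
proof (induction N)
  case 0
  show ?case
    by (rule exI[of _ "\<lambda>s. (s - 1) * hurwitz_series a s"])
       (auto intro!: holomorphic_intros hurwitz_series_holomorphic)
next
  case (Suc N)
  then obtain E where E: "E holomorphic_on {s. 1 - real N < Re s}"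
    "\<And>s. 1 < Re s \<Longrightarrow> E s = (s - 1) * hurwitz_series a s" by blast
  obtain E' where "E' holomorphic_on {s. - real N < Re s}"
    "\<And>s. 1 < Re s \<Longrightarrow> E' s = (s - 1) * hurwitz_series a s" "E' 1 = 1"
    using continuation_step[OF E] by blast
  then show ?case by auto
qed

lemma continuation_entire:
  obtains E where "E holomorphic_on UNIV"
    "\<And>s. 1 < Re s \<Longrightarrow> E s = (s - 1) * hurwitz_series a s" "E 1 = 1"
proof -
  obtain F where "\<forall>N. F N holomorphic_on {s. 1 - real N < Re s} \<and>
      (\<forall>s. 1 < Re s \<longrightarrow> F N s = (s - 1) * hurwitz_series a s) \<and> (N > 0 \<longrightarrow> F N 1 = 1)"
    using choice[OF allI[OF continuation_halfplane]] by (rule exE)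
  then have F: "\<And>N. F N holomorphic_on {s. 1 - real N < Re s}"
    "\<And>N s. 1 < Re s \<Longrightarrow> F N s = (s - 1) * hurwitz_series a s"
    "\<And>N. N > 0 \<Longrightarrow> F N 1 = 1"
    by simp_all
  \<comment> \<open>The index satisfies \<open>N \<ge> 2 - Re s\<close>, so \<open>s\<close> lies
    inside the half-plane of \<open>F N\<close>. By uniqueness any other admissible index gives the
    same value.\<close>
  define E where "E = (\<lambda>s. F (nat \<lceil>2 - Re s\<rceil>) s)"
  have E: "E s = F N s" if "1 - real N < Re s" for N s
    unfolding E_def
    by (rule halfplane_continuation_unique[OF F(1) F(1)]) (use that real_nat_ceiling_ge[of "2 - Re s"] in \<open>auto simp: F(2)\<close>)
  show ?thesis
  proof
    have "E holomorphic_on (\<Union>N. {s. 1 - real N < Re s})"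
    proof (rule holomorphic_on_UN_open)
      fix N show "E holomorphic_on {s. 1 - real N < Re s}"
        using F(1)[of N] by (rule holomorphic_transform) (use E in auto)
    qed (auto intro: open_halfspace_Re_gt)
    also have "(\<Union>N. {s. 1 - real N < Re s}) = UNIV"
    proof -
      have "\<exists>N. 1 - real N < Re s" for s using reals_Archimedean2[of "1 - Re s"] by (auto simp: field_simps)
      then show ?thesis by auto
    qed
    finally show "E holomorphic_on UNIV" .
    show "E 1 = 1" using E[of 1 1] F(3)[of 1] by simp
  qed (use E[of 0] F(2)[of _ 0] in auto)
qed

text \<open>Since \<open>E 1 = 1\<close> is nonzero, \<open>E s / (s - 1)\<close> has a genuine
  simple pole at 1, and division by 0 supplies the prescribed value 0 there.\<close>

lemma is_hurwitz_zeta_hurwitz_zeta: "is_hurwitz_zeta a (hurwitz_zeta a)"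
proof -
  obtain E where E: "E holomorphic_on UNIV"
    "\<And>s. 1 < Re s \<Longrightarrow> E s = (s - 1) * hurwitz_series a s" "E 1 = 1"
    using continuation_entire by blast
  define f where "f = (\<lambda>s. E s / (s - 1))"
  have "f holomorphic_on - {1}"
    unfolding f_def by (intro holomorphic_intros holomorphic_on_subset[OF E(1)]) auto
  moreover have "is_pole f 1"
    unfolding f_def
  proof (rule is_pole_divide)
    show "isCont E 1"
      using holomorphic_on_imp_continuous_on[OF E(1)] by (simp add: continuous_on_eq_continuous_at)
    show "filterlim (\<lambda>s. s - 1 :: complex) (at 0) (at 1)"
      by (auto simp: filterlim_at eventually_at_filter intro!: tendsto_eq_intros)
  qed (use E in auto)
  moreover have "zorder f 1 = - 1"
    by (rule zorder_eqI[of UNIV _ E]) (use E in \<open>auto simp: f_def power_int_minus field_simps\<close>)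
  moreover have "f 1 = 0" by (simp add: f_def)
  moreover have "f s = (\<Sum>n. complex_of_real (real n + a) powr (- s))" if "1 < Re s" for s
    using E(2)[OF that] that by (auto simp: f_def hurwitz_series_def)
  ultimately have "is_hurwitz_zeta a f" by (simp add: is_hurwitz_zeta_def)
  then show ?thesis
    unfolding hurwitz_zeta_def using is_hurwitz_zeta_unique by (metis theI)
qed

end

subsection \<open>Sign of the quadrature error\<close>

text \<open>
  Sign of the error of the Hermite interpolant with a double node at \<open>m\<close> and a simple node at
  \<open>b\<close>: subtracting a multiple of \<open>(x - m)\<^sup>2 (x - b)\<close> creates the extra zero \<open>t\<close>. The derivatives
  are not required at the endpoints, where \<open>x powr p\<close> may be singular.
\<close>

lemma Rolle_third_derivative:
  fixes h h1 h2 h3 :: "real \<Rightarrow> real"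
  assumes cont: "continuous_on {a..b} h"
    and d1: "\<And>x. a < x \<Longrightarrow> x < b \<Longrightarrow> (h has_real_derivative h1 x) (at x)"
    and d2: "\<And>x. a < x \<Longrightarrow> x < b \<Longrightarrow> (h1 has_real_derivative h2 x) (at x)"
    and d3: "\<And>x. a < x \<Longrightarrow> x < b \<Longrightarrow> (h2 has_real_derivative h3 x) (at x)"
    and zeros: "a \<le> t" "t < b" "t \<noteq> m" "a < m" "m < b" "h t = 0" "h m = 0" "h b = 0" "h1 m = 0"
  shows "\<exists>z. a < z \<and> z < b \<and> h3 z = 0"
proof -
  have rolle: "\<exists>z. p < z \<and> z < q \<and> f' z = 0"
    if pq: "p < q" "f p = 0" "f q = 0" "continuous_on {p..q} f"
      "\<And>x. p < x \<Longrightarrow> x < q \<Longrightarrow> (f has_real_derivative f' x) (at x)"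
    for p q and f f' :: "real \<Rightarrow> real"
  proof -
    obtain z where z: "p < z" "z < q" "(\<lambda>v. f' z * v) = (\<lambda>v. 0)"
      using Rolle_deriv[of p q f "\<lambda>x v. f' x * v"] pq
      by (auto simp: has_field_derivative_def)
    then show ?thesis by (metis mult.right_neutral)
  qed
  \<comment> \<open>Only \<open>h\<close> itself is used at the endpoints, where it is merely
    continuous; \<open>h1\<close> and \<open>h2\<close> are treated strictly inside.\<close>
  have rolle_h: "\<exists>z. p < z \<and> z < q \<and> h1 z = 0"
    if "a \<le> p" "p < q" "q \<le> b" "h p = 0" "h q = 0" for p q
  proof (rule rolle[of p q h])
    show "continuous_on {p..q} h"
      using cont by (rule continuous_on_subset) (use that in auto)
  qed (use that in \<open>auto intro!: d1\<close>)
  have rolle_inner: "\<exists>z. p < z \<and> z < q \<and> f' z = 0"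
    if "a < p" "p < q" "q < b" "f p = 0" "f q = 0"
      and f': "\<And>x. a < x \<Longrightarrow> x < b \<Longrightarrow> (f has_real_derivative f' x) (at x)"
    for p q and f f' :: "real \<Rightarrow> real"
  proof (rule rolle[of p q f])
    show "continuous_on {p..q} f"
      by (rule DERIV_continuous_on, rule has_field_derivative_at_within, rule f')
         (use that(1-3) in auto)
  qed (use that(1-5) in \<open>auto intro!: f'\<close>)
  \<comment> \<open>Rolle between adjacent zeros of \<open>h\<close> gives two zeros of
    \<open>h1\<close>; the double zero \<open>m\<close> is the third. Their order depends on the
    side of \<open>m\<close> on which \<open>t\<close> lies.\<close>
  obtain u v w where uvw: "a < u" "u < v" "v < w" "w < b" "h1 u = 0" "h1 v = 0" "h1 w = 0"
  proof (cases "t < m")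
    case True
    obtain u where "t < u" "u < m" "h1 u = 0"
      using rolle_h[of t m] True zeros by auto
    moreover obtain w where "m < w" "w < b" "h1 w = 0"
      using rolle_h[of m b] zeros by auto
    ultimately show thesis using that[of u m w] zeros by auto
  next
    case False
    then have "m < t" using zeros by auto
    then obtain v where "m < v" "v < t" "h1 v = 0"
      using rolle_h[of m t] zeros by auto
    moreover obtain w where "t < w" "w < b" "h1 w = 0"
      using rolle_h[of t b] zeros by auto
    ultimately show thesis using that[of m v w] zeros by auto
  qed
  obtain y where y: "u < y" "y < v" "h2 y = 0"
    using rolle_inner[OF _ _ _ _ _ d2, of u v] uvw by auto
  obtain y' where y': "v < y'" "y' < w" "h2 y' = 0"
    using rolle_inner[OF _ _ _ _ _ d2, of v w] uvw by auto
  obtain z where "y < z" "z < y'" "h3 z = 0"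
    using rolle_inner[OF _ _ _ _ _ d3, of y y'] uvw y y' by auto
  then show ?thesis using uvw y y' by (intro exI[of _ z]) auto
qed

text \<open>
  As \<open>a\<close> is a root of the second Bernoulli polynomial, the functional vanishes on quadratic
  polynomials, in particular on the one that agrees with \<open>g\<close> to second order at \<open>a\<close> and with \<open>g\<close>
  at 1; that one lies above \<open>g\<close>.
\<close>

lemma quadrature_error_pos:
  fixes g g1 g2 g3 :: "real \<Rightarrow> real"
  assumes cont: "continuous_on {0..1} g"
    and d1: "\<And>x. 0 < x \<Longrightarrow> x < 1 \<Longrightarrow> (g has_real_derivative g1 x) (at x)"
    and d2: "\<And>x. 0 < x \<Longrightarrow> x < 1 \<Longrightarrow> (g1 has_real_derivative g2 x) (at x)"
    and d3: "\<And>x. 0 < x \<Longrightarrow> x < 1 \<Longrightarrow> (g2 has_real_derivative g3 x) (at x)"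
    and pos: "\<And>x. 0 < x \<Longrightarrow> x < 1 \<Longrightarrow> g3 x > 0"
    and I: "(g has_integral I) {0..1}"
    and a: "0 < a" "a < 1 / 2" "a\<^sup>2 - a + 1 / 6 = 0"
  shows "g a - I - (a - 1 / 2) * (g 1 - g 0) > 0"
proof -
  define A where "A = g a"
  define B where "B = g1 a"
  define C where "C = (g 1 - A - B * (1 - a)) / (1 - a)\<^sup>2"
  define q where "q = (\<lambda>x. A + B * (x - a) + C * (x - a)\<^sup>2)"
  have q1: "q 1 = g 1" using a by (simp add: q_def C_def)
  have qa: "q a = g a" by (simp add: q_def A_def)
  have less: "g t < q t" if t: "0 \<le> t" "t < 1" "t \<noteq> a" for t
  proof -
    \<comment> \<open>\<open>K\<close> makes \<open>h t = 0\<close>. The cubic has third derivative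
      6, so a zero of the third derivative of \<open>h\<close> gives
      \<open>6 * K = g3 z > 0\<close>, and \<open>g t - q t\<close> then has the sign of
      \<open>t - 1\<close>.\<close>
    define K where "K = (g t - q t) / ((t - a)\<^sup>2 * (t - 1))"
    define h where "h = (\<lambda>x. g x - q x - K * ((x - a)\<^sup>2 * (x - 1)))"
    define h1 where "h1 = (\<lambda>x. g1 x - (B + 2 * C * (x - a)) - K * (2 * (x - a) * (x - 1) + (x - a)\<^sup>2))"
    define h2 where "h2 = (\<lambda>x. g2 x - 2 * C - K * (2 * (x - 1) + 4 * (x - a)))"
    have "\<exists>z. 0 < z \<and> z < 1 \<and> g3 z - 6 * K = 0"
    proof (rule Rolle_third_derivative[of 0 1 h h1 h2 _ t a])
      show "continuous_on {0..1} h"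
        unfolding h_def q_def by (intro continuous_intros cont)
      fix x :: real assume x: "0 < x" "x < 1"
      show "(h has_real_derivative h1 x) (at x)"
        unfolding h_def h1_def q_def
        by (rule derivative_eq_intros d1[OF x] refl | simp add: algebra_simps power2_eq_square)+
      show "(h1 has_real_derivative h2 x) (at x)"
        unfolding h1_def h2_def
        by (rule derivative_eq_intros d2[OF x] refl | simp add: algebra_simps power2_eq_square)+
      show "(h2 has_real_derivative g3 x - 6 * K) (at x)"
        unfolding h2_def
        by (rule derivative_eq_intros d3[OF x] refl | simp add: algebra_simps)+
    next
      show "h t = 0" using t by (simp add: h_def K_def)
      show "h a = 0" by (simp add: h_def qa)
      show "h 1 = 0" by (simp add: h_def q1)
      show "h1 a = 0" by (simp add: h1_def B_def)
    qed (use t a in auto)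
    then obtain z where "0 < z" "z < 1" "g3 z = 6 * K" by auto
    then have K: "K > 0" using pos[of z] by simp
    have "(t - a)\<^sup>2 * (t - 1) < 0"
      using t by (intro mult_pos_neg) auto
    moreover have "g t - q t = K * ((t - a)\<^sup>2 * (t - 1))"
      using t by (simp add: K_def)
    ultimately have "g t - q t < 0" using K by (simp add: mult_pos_neg)
    then show ?thesis by simp
  qed
  define Q where "Q = (\<lambda>x. A * x + B * (x - a)\<^sup>2 / 2 + C * (x - a) ^ 3 / 3)"
  have "(q has_integral (Q 1 - Q 0)) {0..1}"
  proof (rule fundamental_theorem_of_calculus)
    fix x :: real
    have "(Q has_real_derivative q x) (at x)"
      unfolding Q_def q_def
      by (rule derivative_eq_intros refl | simp add: power2_eq_square)+
    then show "(Q has_vector_derivative q x) (at x within {0..1})"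
      by (simp add: has_real_derivative_iff_has_vector_derivative has_vector_derivative_at_within)
  qed simp
  with I have "I \<le> Q 1 - Q 0"
  proof (rule has_integral_le)
    show "g x \<le> q x" if "x \<in> {0..1}" for x
      using less[of x] that q1 qa by (cases "x = a \<or> x = 1") auto
  qed
  \<comment> \<open>The functional kills affine functions and maps \<open>(x - a)\<^sup>2\<close> to
    the second Bernoulli polynomial at \<open>a\<close>.\<close>
  moreover have "q a - (Q 1 - Q 0) - (a - 1 / 2) * (q 1 - q 0) = C * (a\<^sup>2 - a + 1 / 6)"
    unfolding q_def Q_def by (simp add: field_simps power2_eq_square power3_eq_cube)
  then have "q a - (Q 1 - Q 0) - (a - 1 / 2) * (g 1 - q 0) = 0"
    unfolding a(3) q1 by simp
  \<comment> \<open>\<open>q\<close> does not match \<open>g\<close> at 0. This gap also raises the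
    error, and it gives strictness, as the integrals are compared only by
    \<open>\<le>\<close>.\<close>
  moreover have "(a - 1 / 2) * (q 0 - g 0) < 0"
    using less[of 0] a by (intro mult_neg_pos) auto
  moreover have "(a - 1 / 2) * (g 1 - g 0) = (a - 1 / 2) * (g 1 - q 0) + (a - 1 / 2) * (q 0 - g 0)"
    by (simp only: distrib_left[symmetric]) simp
  ultimately show ?thesis
    unfolding qa by linarith
qed

text \<open>
  Error of approximating \<open>f a\<close> by the integral of \<open>f\<close> over \<open>{0..1}\<close> plus \<open>(a - 1 / 2) (f 1 - f 0)\<close>,
  where \<open>f t = (x + t) powr p\<close>.
\<close>

definition powr_error :: "real \<Rightarrow> real \<Rightarrow> real \<Rightarrow> real" where
  "powr_error p x a = (x + a) powr p - ((x + 1) powr (p + 1) - x powr (p + 1)) / (p + 1)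
     - (a - 1 / 2) * ((x + 1) powr p - x powr p)"

lemma b2_root: "b2_minus\<^sup>2 - b2_minus + 1 / 6 = 0" "0 < b2_minus" "b2_minus < 1 / 2" "b2_plus = 1 - b2_minus"
proof -
  have "sqrt 3 < 3" using real_sqrt_less_mono[of 3 9] by simp
  then show "0 < b2_minus" by (simp add: b2_minus_def)
qed (simp_all add: b2_minus_def b2_plus_def power2_eq_square field_simps)

context
  fixes p x :: real
  assumes p: "0 < p" "p < 1" and x: "x \<ge> 0"
begin

lemma powr_has_integral_unit:
  "((\<lambda>t. (x + t) powr p) has_integral ((x + 1) powr (p + 1) - x powr (p + 1)) / (p + 1)) {0..1}"
proof -
  define F where "F = (\<lambda>t. (x + t) powr (p + 1) / (p + 1))"
  have "((\<lambda>t. (x + t) powr p) has_integral (F 1 - F 0)) {0..1}"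
  proof (rule fundamental_theorem_of_calculus_interior)
    show "continuous_on {0..1} F"
      unfolding F_def using p x by (intro continuous_intros continuous_on_powr') auto
    fix t :: real assume t: "t \<in> {0<..<1}"
    have "(F has_real_derivative (x + t) powr p) (at t)"
      unfolding F_def by (rule derivative_eq_intros refl | use t p x in simp)+
    then show "(F has_vector_derivative (x + t) powr p) (at t)"
      by (simp add: has_real_derivative_iff_has_vector_derivative)
  qed simp
  then show ?thesis by (simp add: F_def diff_divide_distrib)
qed

lemma powr_shift_derivs:
  assumes "t > 0"
  shows "((\<lambda>t. (x + t) powr p) has_real_derivative p * (x + t) powr (p - 1)) (at t)"
    "((\<lambda>t. p * (x + t) powr (p - 1)) has_real_derivative p * (p - 1) * (x + t) powr (p - 2)) (at t)"
    "((\<lambda>t. p * (p - 1) * (x + t) powr (p - 2)) has_real_derivative p * (p - 1) * (p - 2) * (x + t) powr (p - 3)) (at t)"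
  using assms p x by (auto intro!: derivative_eq_intros)

section \<open>Sign of the error at the three nodes\<close>

text \<open>For \<open>0 < p < 1\<close> the factors \<open>p - 1\<close> and \<open>p - 2\<close>
  are both negative, so the third derivative is positive.\<close>

lemma powr_error_b2_minus: "powr_error p x b2_minus > 0"
proof -
  have "(x + b2_minus) powr p - ((x + 1) powr (p + 1) - x powr (p + 1)) / (p + 1)
     - (b2_minus - 1 / 2) * ((x + 1) powr p - (x + 0) powr p) > 0"
  proof (rule quadrature_error_pos)
    show "continuous_on {0..1} (\<lambda>t. (x + t) powr p)"
      using p x by (intro continuous_intros continuous_on_powr') auto
    show "p * (p - 1) * (p - 2) * (x + t) powr (p - 3) > 0" if "0 < t" "t < 1" for t
      using p x that by (simp add: zero_less_mult_iff mult_less_0_iff)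
  qed (use powr_shift_derivs powr_has_integral_unit b2_root in auto)
  then show ?thesis by (simp add: powr_error_def)
qed

text \<open>The reflection \<open>t \<mapsto> 1 - t\<close>, with a change of sign to keep the third derivative positive.\<close>

lemma powr_error_b2_plus: "powr_error p x b2_plus < 0"
proof -
  let ?g = "\<lambda>t. - ((x + (1 - t)) powr p)"
  have d: "((\<lambda>t. f (1 - t)) has_real_derivative - f') (at t)"
    if "(f has_real_derivative f') (at (1 - t))" for f f' and t :: real
  proof -
    have "((\<lambda>t. 1 - t) has_real_derivative - 1) (at t)"
      by (auto intro!: derivative_eq_intros)
    from DERIV_chain2[where f = f and g = "\<lambda>t. 1 - t" and x = t, OF that this] show ?thesis by simp
  qed
  \<comment> \<open>Reflection negates \<open>a - 1 / 2\<close> and preserves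
    \<open>?g 1 - ?g 0 = (x + 1) powr p - x powr p\<close>, so this quantity is
    \<open>- powr_error p x b2_plus\<close>.\<close>
  have "?g b2_minus - (- (((x + 1) powr (p + 1) - x powr (p + 1)) / (p + 1)))
     - (b2_minus - 1 / 2) * (?g 1 - ?g 0) > 0"
  proof (rule quadrature_error_pos)
    show "continuous_on {0..1} ?g"
      using p x by (intro continuous_intros continuous_on_powr') auto
    fix t :: real assume t: "0 < t" "t < 1"
    then have t': "1 - t > 0" by simp
    note D = powr_shift_derivs[OF t', THEN d]
    show "(?g has_real_derivative p * (x + (1 - t)) powr (p - 1)) (at t)"
      using DERIV_minus[OF D(1)] by simp
    show "((\<lambda>t. p * (x + (1 - t)) powr (p - 1)) has_real_derivative - (p * (p - 1) * (x + (1 - t)) powr (p - 2))) (at t)"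
      using D(2) by simp
    show "((\<lambda>t. - (p * (p - 1) * (x + (1 - t)) powr (p - 2))) has_real_derivative p * (p - 1) * (p - 2) * (x + (1 - t)) powr (p - 3)) (at t)"
      using DERIV_minus[OF D(3)] by simp
    show "p * (p - 1) * (p - 2) * (x + (1 - t)) powr (p - 3) > 0"
      using p x t by (simp add: zero_less_mult_iff mult_less_0_iff)
  next
    have "((\<lambda>t. (x + (- 1 * t + 1)) powr p) has_integral (1 / \<bar>-1\<bar>) *\<^sub>R (((x + 1) powr (p + 1) - x powr (p + 1)) / (p + 1)))
      ((\<lambda>t. (1 / -1) *\<^sub>R t + - ((1 / -1) *\<^sub>R 1)) ` {0..1})"
      using has_integral_affinity[of "\<lambda>t. (x + t) powr p" _ 0 1 "-1" 1] powr_has_integral_unit by simp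
    moreover have "(\<lambda>t. (1 / -1) *\<^sub>R t + - ((1 / -1) *\<^sub>R 1)) ` {0..1} = {0..1 :: real}"
      by (auto simp: image_iff intro!: bexI[of _ "1 - t" for t])
    ultimately show "(?g has_integral - (((x + 1) powr (p + 1) - x powr (p + 1)) / (p + 1))) {0..1}"
      by (intro has_integral_neg) simp
  qed (use b2_root in auto)
  then show ?thesis by (simp add: powr_error_def b2_root(4) algebra_simps)
qed

text \<open>The endpoint correction vanishes at \<open>1 / 2\<close>, leaving the strict midpoint
  inequality for a concave function. The excess \<open>u t\<close> over the interval of radius
  \<open>t\<close> about \<open>m\<close> has derivative \<open>v t\<close>; both start at 0, and
  \<open>v\<close> increases because \<open>z powr (p - 1)\<close> decreases.\<close>

lemma powr_error_half: "powr_error p x (1 / 2) > 0"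
proof -
  define m where "m = x + 1 / 2"
  define u where "u = (\<lambda>t. 2 * t * m powr p - ((m + t) powr (p + 1) - (m - t) powr (p + 1)) / (p + 1))"
  define v where "v = (\<lambda>t. 2 * m powr p - (m + t) powr p - (m - t) powr p)"
  have m: "m \<ge> 1 / 2" using x by (simp add: m_def)
  have "u 0 < u (1 / 2)"
  proof (rule DERIV_pos_imp_increasing_open[of 0 "1 / 2" u])
    show "continuous_on {0..1 / 2} u"
      unfolding u_def using p m by (intro continuous_intros continuous_on_powr') auto
    fix t :: real assume t: "0 < t" "t < 1 / 2"
    have "v 0 < v t"
    proof (rule DERIV_pos_imp_increasing_open[of 0 t v])
      show "continuous_on {0..t} v"
        unfolding v_def using p m t by (intro continuous_intros continuous_on_powr') auto
      fix s assume s: "0 < s" "s < t"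
      have "(v has_real_derivative p * ((m - s) powr (p - 1) - (m + s) powr (p - 1))) (at s)"
        unfolding v_def using s t m by (auto intro!: derivative_eq_intros simp: algebra_simps)
      moreover have "0 < p * ((m - s) powr (p - 1) - (m + s) powr (p - 1))"
        using s t m p by (simp add: powr_less_mono2_neg)
      ultimately show "\<exists>y. (v has_real_derivative y) (at s) \<and> 0 < y"
        by blast
    qed (use t in auto)
    then have "v t > 0" by (simp add: v_def)
    moreover have "(u has_real_derivative v t) (at t)"
    proof -
      have "((\<lambda>t. (m + t) powr (p + 1)) has_real_derivative (p + 1) * (m + t) powr p) (at t)"
        "((\<lambda>t. (m - t) powr (p + 1)) has_real_derivative - ((p + 1) * (m - t) powr p)) (at t)"
        using t m by (auto intro!: derivative_eq_intros)
      from DERIV_cdivide[OF DERIV_diff[OF this], of "p + 1"]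
      have "((\<lambda>t. ((m + t) powr (p + 1) - (m - t) powr (p + 1)) / (p + 1)) has_real_derivative
          (m + t) powr p + (m - t) powr p) (at t)"
        using p by (simp add: add_divide_distrib)
      moreover have "((\<lambda>t. 2 * t * m powr p) has_real_derivative 2 * m powr p) (at t)"
        by (auto intro!: derivative_eq_intros)
      ultimately show ?thesis
        unfolding u_def v_def diff_diff_eq by (intro DERIV_diff)
    qed
    ultimately show "\<exists>y. (u has_real_derivative y) (at t) \<and> 0 < y" by blast
  qed auto
  then show ?thesis by (simp add: u_def m_def powr_error_def add.commute)
qed

section \<open>Concavity in \<open>a\<close> and the remaining parameters\<close>

text \<open>The integral is constant in \<open>a\<close> and the correction is affine, so only
  \<open>(x + a) powr p\<close> contributes to the second derivative.\<close>

lemma powr_error_concave: "concave_on {0<..} (powr_error p x)"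
proof (rule f''_le0_imp_concave)
  fix a :: real assume "a \<in> {0<..}"
  then have a: "a > 0" by simp
  show "(powr_error p x has_real_derivative p * (x + a) powr (p - 1) - ((x + 1) powr p - x powr p)) (at a)"
    unfolding powr_error_def
    by (rule derivative_eq_intros powr_shift_derivs(1)[OF a] refl | simp)+
  show "((\<lambda>a. p * (x + a) powr (p - 1) - ((x + 1) powr p - x powr p)) has_real_derivative
      p * (p - 1) * (x + a) powr (p - 2)) (at a)"
    by (rule derivative_eq_intros powr_shift_derivs(2)[OF a] refl | simp)+
  show "p * (p - 1) * (x + a) powr (p - 2) \<le> 0"
    using p by (intro mult_nonpos_nonneg mult_nonneg_nonpos) auto
qed simp

text \<open>A concave function that is positive at both ends of an interval is positive on
  it.\<close>

lemma powr_error_pos: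
  assumes "b2_minus \<le> a" "a \<le> 1 / 2"
  shows "powr_error p x a > 0"
proof -
  define t where "t = (a - b2_minus) / (1 / 2 - b2_minus)"
  have t: "0 \<le> t" "t \<le> 1" using assms b2_root by (auto simp: t_def)
  have "t * (1 / 2 - b2_minus) = a - b2_minus"
    using b2_root(3) by (simp add: t_def)
  then have a: "a = (1 - t) *\<^sub>R b2_minus + t *\<^sub>R (1 / 2)"
    by (simp add: algebra_simps)
  have "0 < (1 - t) * powr_error p x b2_minus + t * powr_error p x (1 / 2)"
  proof (cases "t = 0")
    case False
    then show ?thesis using t powr_error_b2_minus powr_error_half
      by (intro add_nonneg_pos mult_pos_pos mult_nonneg_nonneg) auto
  qed (use powr_error_b2_minus in auto)
  also have "\<dots> \<le> powr_error p x a"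
    unfolding a using t b2_root by (intro concave_onD[OF powr_error_concave]) auto
  finally show ?thesis .
qed

text \<open>\<open>b2_plus\<close> lies between \<open>1 / 2\<close> and \<open>a\<close>. The error
  is positive at \<open>1 / 2\<close>, so a nonnegative error at \<open>a\<close> would force one at
  \<open>b2_plus\<close> by concavity.\<close>

lemma powr_error_neg:
  assumes "b2_plus \<le> a"
  shows "powr_error p x a < 0"
proof (rule ccontr)
  assume neg: "\<not> powr_error p x a < 0"
  define t where "t = (b2_plus - 1 / 2) / (a - 1 / 2)"
  have b: "b2_plus > 1 / 2" using b2_root by simp
  then have t: "0 \<le> t" "t \<le> 1" using assms by (auto simp: t_def)
  have "t * (a - 1 / 2) = b2_plus - 1 / 2"
    using b assms by (simp add: t_def)
  then have eq: "b2_plus = (1 - t) *\<^sub>R (1 / 2) + t *\<^sub>R a"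
    by (simp add: field_simps)
  have "0 \<le> (1 - t) * powr_error p x (1 / 2) + t * powr_error p x a"
    using t neg powr_error_half by (intro add_nonneg_nonneg mult_nonneg_nonneg) auto
  also have "\<dots> \<le> powr_error p x b2_plus"
    unfolding eq using t b assms by (intro concave_onD[OF powr_error_concave]) auto
  finally show False using powr_error_b2_plus by simp
qed

end

subsection \<open>The series in the strip\<close>

text \<open>
  The two correction terms telescope to 0, and they make the series converge for \<open>Re s > -1\<close>.
  The convention \<open>0 powr z = 0\<close> makes the summand for \<open>n = 0\<close> correct even where \<open>0\<close> would be raised
  to a power with negative real part.
\<close>

definition strip_term :: "real \<Rightarrow> nat \<Rightarrow> complex \<Rightarrow> complex" where
  "strip_term a n s = of_real (real n + a) powr (- s)
     - (of_real (real n + 1) powr (1 - s) - of_real (real n) powr (1 - s)) / (1 - s)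
     - of_real (a - 1 / 2) * (of_real (real n + 1) powr (- s) - of_real (real n) powr (- s))"

text \<open>Expanding all powers about \<open>n\<close>, the terms in \<open>n powr (- s)\<close>
  and \<open>n powr (- s - 1)\<close> cancel, the latter because
  \<open>- a + 1 / 2 + (a - 1 / 2) = 0\<close>. The Taylor remainders \<open>A\<close>,
  \<open>B\<close>, \<open>C\<close> are left.\<close>

lemma norm_strip_term_le:
  assumes "a > 0" "n \<ge> 1" "- 1 < Re s" "s \<noteq> 1"
  shows "norm (strip_term a n s) \<le>
     (2 * norm ((- s) gchoose 2) * a\<^sup>2 + 3 * norm ((1 - s) gchoose 3) / norm (1 - s)
       + \<bar>a - 1 / 2\<bar> * (2 * norm ((- s) gchoose 2))) * real n powr - (Re s + 2)"
proof -
  let ?N = "complex_of_real (real n)" and ?r = "real n powr - (Re s + 2)"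
  define A where "A = of_real (real n + a) powr (- s) - (?N powr (- s) - s * ?N powr (- s - 1) * of_real a)"
  define B where "B = of_real (real n + 1) powr (1 - s) -
    (?N powr (1 - s) + (1 - s) * ?N powr (- s) + (1 - s) * (- s) / 2 * ?N powr (- s - 1))"
  define C where "C = of_real (real n + 1) powr (- s) - (?N powr (- s) - s * ?N powr (- s - 1))"
  have e: "Re (- s) - 2 = - (Re s + 2)" "Re (1 - s) - 3 = - (Re s + 2)" by auto
  have *: "(1 - s) gchoose 2 = (1 - s) * (- s) / 2"
    by (simp add: gbinomial_prod_rev numeral_2_eq_2)
  have **: "1 - s - 1 = - s" "1 - s - 2 = - s - 1" by auto
  have sums: "(\<Sum>i\<le>1. f i) = f 0 + f 1" "(\<Sum>i\<le>2. f i) = f 0 + f 1 + f 2" for f :: "nat \<Rightarrow> complex"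
    by (simp_all add: eval_nat_numeral)
  have Suc: "Suc 1 = 2" "Suc 2 = 3" by simp_all
  have "norm A \<le> real 2 * norm ((- s) gchoose 2) * real n powr (Re (- s) - real 2) * a ^ 2"
    using powr_Taylor_bound[of "real n" a "- s" 1, unfolded sums Suc] assms by (simp add: A_def)
  then have A: "norm A \<le> 2 * norm ((- s) gchoose 2) * a\<^sup>2 * ?r"
    by (simp add: e mult_ac)
  have "norm B \<le> real 3 * norm ((1 - s) gchoose 3) * real n powr (Re (1 - s) - real 3) * 1 ^ 3"
    using powr_Taylor_bound[of "real n" 1 "1 - s" 2, unfolded sums Suc * of_nat_numeral of_nat_1 **] assms
    by (simp add: B_def)
  then have B: "norm B \<le> 3 * norm ((1 - s) gchoose 3) * ?r"
    by (simp only: e of_nat_numeral power_one mult_1_right)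
  have "norm C \<le> real 2 * norm ((- s) gchoose 2) * real n powr (Re (- s) - real 2) * 1 ^ 2"
    using powr_Taylor_bound[of "real n" 1 "- s" 1, unfolded sums Suc] assms by (simp add: C_def)
  then have C: "norm C \<le> 2 * norm ((- s) gchoose 2) * ?r"
    by (simp add: e)
  have "strip_term a n s = A - B / (1 - s) - of_real (a - 1 / 2) * C"
    using assms(4) by (simp add: strip_term_def A_def B_def C_def field_simps)
  also have "norm \<dots> \<le> norm A + norm B / norm (1 - s) + \<bar>a - 1 / 2\<bar> * norm C"
    by (intro order.trans[OF norm_triangle_ineq4] add_mono) (auto simp: norm_divide norm_mult simp del: of_real_diff)
  also have "\<dots> \<le> 2 * norm ((- s) gchoose 2) * a\<^sup>2 * ?r + (3 * norm ((1 - s) gchoose 3) * ?r) / norm (1 - s)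
       + \<bar>a - 1 / 2\<bar> * (2 * norm ((- s) gchoose 2) * ?r)"
    by (intro add_mono A divide_right_mono B mult_left_mono C) auto
  finally show ?thesis by (simp add: algebra_simps)
qed

text \<open>For \<open>Re s > 1\<close> the corrections telescope away and the Hurwitz series
  remains. Both sides are holomorphic on the punctured half-plane \<open>U\<close>, so the identity
  theorem extends the equality.\<close>

lemma strip_term_sums_hurwitz_zeta:
  assumes a: "a > 0" and s: "- 1 < Re s" "s \<noteq> 1"
  shows "(\<lambda>n. strip_term a n s) sums hurwitz_zeta a s"
proof -
  define U where "U = {s. - 1 < Re s} - {1 :: complex}"
  have "open U" unfolding U_def by (auto intro: open_halfspace_Re_gt)
  have conn: "connected U"
    unfolding U_def by (intro connected_open_delete open_halfspace_Re_gt connected_halfspace_Re_gt) simp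
  have hol: "strip_term a n holomorphic_on U" for n
  \<comment> \<open>For \<open>n = 0\<close> the powers of 0 are constantly 0, whereas the rule for
    powers with a variable exponent needs a positive base.\<close>
  proof (cases "n = 0")
    case True
    then show ?thesis
      unfolding strip_term_def U_def using a by (auto intro!: holomorphic_intros)
  next
    case False
    then show ?thesis
      unfolding strip_term_def using a by (intro holomorphic_intros) (auto simp: U_def)
  qed
  note summ = holomorphic_suminf_powr_bound[where U = U and g = "strip_term a" and q = 2,
      OF \<open>open U\<close> hol _ norm_strip_term_le[OF a]]
  have cont: "continuous_on U (\<lambda>s. 2 * norm ((- s) gchoose 2) * a\<^sup>2 + 3 * norm ((1 - s) gchoose 3) / norm (1 - s)
       + \<bar>a - 1 / 2\<bar> * (2 * norm ((- s) gchoose 2)))"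
    by (intro continuous_intros holomorphic_on_imp_continuous_on holomorphic_intros) (auto simp: U_def)
  have hz: "is_hurwitz_zeta a (hurwitz_zeta a)" by (rule is_hurwitz_zeta_hurwitz_zeta[OF a])
  have big: "(\<lambda>n. strip_term a n z) sums hurwitz_zeta a z" if z: "Re z > 1" for z
  proof -
    \<comment> \<open>The sum is the limit minus the initial value, and both are 0 because
      \<open>0 powr w = 0\<close>.\<close>
    have tel: "(\<lambda>n. of_real (real n + 1) powr w - of_real (real n) powr w) sums (0 :: complex)"
      if "Re w < 0" for w
    proof -
      have "(\<lambda>n. real n powr Re w) \<longlonglongrightarrow> 0"
        using that by (intro tendsto_neg_powr filterlim_real_sequentially)
      moreover have "norm (complex_of_real (real n) powr w) = real n powr Re w" for n
        by (subst norm_powr_real_powr) auto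
      ultimately have "(\<lambda>n. complex_of_real (real n) powr w) \<longlonglongrightarrow> 0"
        by (subst tendsto_norm_zero_iff [symmetric]) (simp del: of_real_of_nat_eq)
      from telescope_sums[OF this] show ?thesis by (simp add: add_ac)
    qed
    have "(\<lambda>n. strip_term a n z) sums (hurwitz_series a z - 0 / (1 - z) - of_real (a - 1 / 2) * 0)"
      unfolding strip_term_def using z
      by (intro sums_diff sums_divide sums_mult hurwitz_series_sums[OF a] tel) auto
    then show ?thesis
      using hz z by (simp add: is_hurwitz_zeta_def hurwitz_series_def)
  qed
  have lim: "2 islimpt {s. 1 < Re s}"
    by (intro open_imp_islimpt open_halfspace_Re_gt) simp
  have "(\<lambda>s. (\<Sum>n. strip_term a n s) - hurwitz_zeta a s) holomorphic_on U"
  proof (intro holomorphic_intros)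
    show "(\<lambda>s. \<Sum>n. strip_term a n s) holomorphic_on U"
      by (rule summ(1)) (use cont in \<open>auto simp: U_def\<close>)
    have "hurwitz_zeta a holomorphic_on - {1}" using hz by (simp add: is_hurwitz_zeta_def)
    then show "hurwitz_zeta a holomorphic_on U" by (rule holomorphic_on_subset) (auto simp: U_def)
  qed
  then have "(\<Sum>n. strip_term a n s) - hurwitz_zeta a s = 0"
    by (rule analytic_continuation[OF _ \<open>open U\<close> conn _ _ lim])
       (use s big in \<open>auto simp: U_def sums_iff\<close>)
  moreover have "summable (\<lambda>n. strip_term a n s)"
    by (rule summ(2)) (use cont s in \<open>auto simp: U_def\<close>)
  ultimately show ?thesis by (simp add: sums_iff)
qed

text \<open>At a real argument all bases are nonnegative and all exponents real, so each strip term
  is the real quadrature error for \<open>p = - \<sigma>\<close>.\<close>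

lemma powr_error_sums_hurwitz_zeta:
  assumes "a > 0" "- 1 < \<sigma>" "\<sigma> < 1"
  shows "(\<lambda>n. complex_of_real (powr_error (- \<sigma>) (real n) a)) sums hurwitz_zeta a (of_real \<sigma>)"
proof -
  have "strip_term a n (of_real \<sigma>) = complex_of_real (powr_error (- \<sigma>) (real n) a)" for n
  proof -
    have "complex_of_real x powr (- of_real \<sigma>) = of_real (x powr (- \<sigma>))"
      "complex_of_real x powr (1 - of_real \<sigma>) = of_real (x powr (1 - \<sigma>))" if "x \<ge> 0" for x
      using powr_of_real[OF that, of "- \<sigma>"] powr_of_real[OF that, of "1 - \<sigma>"] by simp_all
    then show ?thesis
      using assms unfolding strip_term_def powr_error_def
      by (simp add: add.commute del: of_real_of_nat_eq of_real_add)
  qed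
  then show ?thesis
    using strip_term_sums_hurwitz_zeta[of a "of_real \<sigma>"] assms by simp
qed

theorem proposition2p4:
  fixes \<sigma> a :: real
  assumes "-1 < \<sigma>" and "\<sigma> < 0"
  shows "(b2_minus \<le> a \<and> a \<le> 1 / 2 \<longrightarrow>
            hurwitz_zeta a (complex_of_real \<sigma>) \<in> \<real> \<and> Re (hurwitz_zeta a (complex_of_real \<sigma>)) > 0) \<and>
         (b2_plus \<le> a \<and> a \<le> 1 \<longrightarrow>
            hurwitz_zeta a (complex_of_real \<sigma>) \<in> \<real> \<and> Re (hurwitz_zeta a (complex_of_real \<sigma>)) < 0)"
proof -
  let ?e = "\<lambda>n. powr_error (- \<sigma>) (real n) a"
  have hz: "summable ?e" "hurwitz_zeta a (of_real \<sigma>) = of_real (\<Sum>n. ?e n)" if "a > 0"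
  proof -
    have *: "(\<lambda>n. complex_of_real (?e n)) sums hurwitz_zeta a (of_real \<sigma>)"
      using that assms by (intro powr_error_sums_hurwitz_zeta) auto
    from sums_Re[OF this] show "summable ?e" by (simp add: sums_iff)
    then have "(\<lambda>n. complex_of_real (?e n)) sums of_real (\<Sum>n. ?e n)"
      by (intro sums_of_real summable_sums)
    with * show "hurwitz_zeta a (of_real \<sigma>) = of_real (\<Sum>n. ?e n)" by (rule sums_unique2)
  qed
  have p: "0 < - \<sigma>" "- \<sigma> < 1" using assms by auto
  show ?thesis
  proof (intro conjI impI; elim conjE)
    assume a: "b2_minus \<le> a" "a \<le> 1 / 2"
    then have "a > 0" using b2_root by linarith
    then have "0 < (\<Sum>n. ?e n)"
      using hz(1) powr_error_pos[OF p _ a] by (intro suminf_pos) auto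
    then show "hurwitz_zeta a (complex_of_real \<sigma>) \<in> \<real>" "Re (hurwitz_zeta a (complex_of_real \<sigma>)) > 0"
      using hz(2)[OF \<open>a > 0\<close>] by auto
  next
    assume a: "b2_plus \<le> a" "a \<le> 1"
    then have "a > 0" using b2_root by linarith
    have "0 < (\<Sum>n. - ?e n)"
      using hz(1)[OF \<open>a > 0\<close>] powr_error_neg[OF p _ a(1)] by (intro suminf_pos summable_minus) auto
    then have "(\<Sum>n. ?e n) < 0"
      using suminf_minus[OF hz(1)[OF \<open>a > 0\<close>]] by simp
    then show "hurwitz_zeta a (complex_of_real \<sigma>) \<in> \<real>" "Re (hurwitz_zeta a (complex_of_real \<sigma>)) < 0"
      using hz(2)[OF \<open>a > 0\<close>] by auto
  qed
qed

end
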